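(* Fix an outlier mode of frequency $\varpi>0$ (with $h\varpi\ge\omega_c$, so that it is multiplied by $R_D(ih\varpi)$ at each step) and a fixed window $[0,T]$ integrated in $T/h$ steps. For each of MIISO2, MIISO3, MIISO4 the retained amplitude satisfies $$\bigl|R_D(ih\varpi)\bigr|^{T/h}=\exp\Bigl(-\tfrac{c}{2}\,T\,h^{q-1}\varpi^{q}\Bigr)\bigl(1+o(1)\bigr)\qquad(h\to0),$$ with $(c,q)=(\tfrac14,4)$ for MIISO2, $(c,q)=(\tfrac1{36},4)$ for MIISO3, and $(c,q)=(\tfrac1{576},6)$ for MIISO4. The factor on the right tends to $1$ as $h\to0$. The rate (the power $h^{q-1}$ in the exponent) is $h^3$ for MIISO2 and MIISO3, and $h^5$ for MIISO4.
   Context: $[m/n]$ is the Padé approximant of $e^z$ (numerator degree $m$, denominator degree $n$, denominator value $1$ at $0$, error $O(z^{m+n+1})$). $Q_N(z)=\sum_{j=0}^N(-z)^j/j!$, $[0/N]=1/Q_N$. The dissipative parent $R_D$ is: for MIISO2, $R_D=[0/2]$; for MIISO3 and MIISO4, the repaired map below with $N=3$ and $N=4$ respectively. Let $\mathcal{W}_N=\{\mathrm{Re}(z)\le0,\ |Q_N(z)|<1\}$ (it contains $i\omega$ for $0<|\omega|<\omega_*$, with $\omega_*=\sqrt3$ for $N=3$ and $\sqrt8$ for $N=4$), $R_{\mathrm{raw}}=[0/N]$, $R_{\mathrm{fix}}=[1/(N-1)]$, $\delta=0.10$, and for $0<|y|<\omega_*$ let $x_b(y)<0$ be the unique negative root $x$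 of $|Q_N(x+iy)|=1$. The weight $\theta_{\mathrm{wedge}}(z)\in[0,1]$ equals $1$ on $\mathcal{W}_N$ and at the origin, decreases linearly to $0$ across a transition pad around $\mathcal{W}_N$ with outer edge $\mathrm{Re}(z)=(1+\delta)x_b(\mathrm{Im}(z))$ or $|\mathrm{Im}(z)|=(1+\delta)\omega_*$, and is $0$ outside. With $\theta=\theta_{\mathrm{wedge}}(z)$, $R_D(z)=|R_{\mathrm{fix}}(z)|^{\theta}|R_{\mathrm{raw}}(z)|^{1-\theta}\exp(i[(1-\theta)\arg R_{\mathrm{raw}}(z)+\theta\arg R_{\mathrm{fix}}(z)])$; so $R_D=R_{\mathrm{fix}}$ where $\theta=1$. Here $h>0$ is the step size and $\omega_c$ the cutoff, which scales with $h$ (it is the modulus of the $k$-th largest-magnitude eigenvalue of $hJ$, $J$ the Jacobian); modes with $h\varpi\ge\omega_c$ are outliers and are advanced by $R_D$. *)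

theory Defs
  imports
    Complex_Main
    "HOL-Library.Landau_Symbols"
    "Jordan_Normal_Form.Char_Poly"
begin

section \<open>Pade approximants of the exponential\<close>

definition is_pade_exp :: "nat \<Rightarrow> nat \<Rightarrow> complex poly \<Rightarrow> complex poly \<Rightarrow> bool" where
  "is_pade_exp m n P Q \<longleftrightarrow>
     degree P = m \<and> degree Q = n \<and> poly Q 0 = 1 \<and>
     (\<lambda>z. exp z - poly P z / poly Q z) \<in> O[at 0](\<lambda>z. z ^ (m + n + 1))"

definition pade_exp :: "nat \<Rightarrow> nat \<Rightarrow> complex \<Rightarrow> complex" where
  "pade_exp m n z =
     (let (P, Q) = (THE (P, Q). is_pade_exp m n P Q) in poly P z / poly Q z)"


section \<open>The repaired map\<close>

definition Q_poly :: "nat \<Rightarrow> complex \<Rightarrow> complex" where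
  "Q_poly N z = (\<Sum>j\<le>N. (- z) ^ j / fact j)"

definition wedge :: "nat \<Rightarrow> complex set" where
  "wedge N = {z. Re z \<le> 0 \<and> cmod (Q_poly N z) < 1}"

text \<open>The next three notions are meant for \<open>N = 3\<close> and \<open>N = 4\<close> only.\<close>

definition omega_star :: "nat \<Rightarrow> real" where
  "omega_star N = (if N = 3 then sqrt 3 else sqrt 8)"

definition x_b :: "nat \<Rightarrow> real \<Rightarrow> real" where
  "x_b N y = (THE x. x < 0 \<and> cmod (Q_poly N (Complex x y)) = 1)"

definition pad_width :: real where
  "pad_width = 1 / 10"

text \<open>
  The wedge lies in the strip \<open>\<bar>Im z\<bar> < omega_star N\<close>, where it is the region between the curve
  \<open>Re z = x_b N (Im z)\<close> and the imaginary axis. The transition pad consists of a part to the left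
  of that curve, across which the weight is affine in \<open>Re z\<close>, and a part beyond
  \<open>\<bar>Im z\<bar> = omega_star N\<close>, across which it is affine in \<open>\<bar>Im z\<bar>\<close>. On the imaginary axis the
  latter ramp starts at 1. For \<open>Re z < 0\<close> the wedge has no points at the height
  \<open>omega_star N\<close>, and the starting value \<open>\<kappa> (Re z)\<close> of the ramp is left open (0 is allowed, and
  then that part of the pad lies on the imaginary axis). The negative real axis counts as outside,
  since \<open>x_b N y\<close> tends to 0 as \<open>y\<close> tends to 0.
\<close>

definition is_wedge_weight :: "nat \<Rightarrow> (complex \<Rightarrow> real) \<Rightarrow> bool" where
  "is_wedge_weight N \<theta> \<longleftrightarrow>
     (\<forall>z. 0 \<le> \<theta> z \<and> \<theta> z \<le> 1) \<and>
     (\<forall>z \<in> insert 0 (wedge N). \<theta> z = 1) \<and>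
     (\<forall>z. z \<notin> insert 0 (wedge N) \<longrightarrow>
        0 < \<bar>Im z\<bar> \<and> \<bar>Im z\<bar> < omega_star N \<and>
        (1 + pad_width) * x_b N (Im z) \<le> Re z \<and> Re z \<le> x_b N (Im z) \<longrightarrow>
        \<theta> z = (Re z - (1 + pad_width) * x_b N (Im z)) / (- pad_width * x_b N (Im z))) \<and>
     (\<exists>\<kappa> :: real \<Rightarrow> real. \<kappa> 0 = 1 \<and> (\<forall>x. 0 \<le> \<kappa> x \<and> \<kappa> x \<le> 1) \<and>
        (\<forall>z. z \<notin> insert 0 (wedge N) \<longrightarrow>
           Re z \<le> 0 \<and> omega_star N \<le> \<bar>Im z\<bar> \<and> \<bar>Im z\<bar> \<le> (1 + pad_width) * omega_star N \<longrightarrow>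
           \<theta> z = \<kappa> (Re z) *
             (((1 + pad_width) * omega_star N - \<bar>Im z\<bar>) / (pad_width * omega_star N)))) \<and>
     (\<forall>z. z \<notin> insert 0 (wedge N) \<longrightarrow>
        Re z > 0 \<or> Im z = 0 \<or> \<bar>Im z\<bar> \<ge> (1 + pad_width) * omega_star N \<or>
        (0 < \<bar>Im z\<bar> \<and> \<bar>Im z\<bar> < omega_star N \<and> Re z \<le> (1 + pad_width) * x_b N (Im z)) \<longrightarrow>
        \<theta> z = 0)"

lemma wedge_weight_exists: "\<exists>\<theta>. is_wedge_weight N \<theta>"
proof -
  define w where "w = omega_star N"
  have w: "w > 0" by (simp add: w_def omega_star_def)
  define \<theta> where "\<theta> = (\<lambda>z. if z \<in> insert 0 (wedge N) then (1::real)
    else if 0 < \<bar>Im z\<bar> \<and> \<bar>Im z\<bar> < w \<and> (1 + pad_width) * x_b N (Im z) \<le> Re z \<and> Re z \<le> x_b N (Im z) \<and> Re z \<le> 0 then (Re z - (1 + pad_width) * x_b N (Im z)) / (- pad_width * x_b N (Im z))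
    else if Re z = 0 \<and> w \<le> \<bar>Im z\<bar> \<and> \<bar>Im z\<bar> \<le> (1 + pad_width) * w then ((1 + pad_width) * w - \<bar>Im z\<bar>) / (pad_width * w) else 0)"
  have "is_wedge_weight N \<theta>" unfolding is_wedge_weight_def w_def[symmetric]
  proof (intro conjI allI exI[of _ "\<lambda>x. if x = 0 then 1 else 0"] ballI impI, goal_cases)
    case (1 z)
    show ?case using w by (auto simp: \<theta>_def pad_width_def divide_simps)
  next
    case (2 z)
    show ?case using w by (auto simp: \<theta>_def pad_width_def divide_simps)
  next
    case (3 z) then show ?case by (auto simp: \<theta>_def)
  next
    case (4 z) then show ?case by (auto simp: \<theta>_def pad_width_def)
  next
    case 5 then show ?case by auto
  next
    case (6 z) then show ?case by auto
  next
    case (7 z) then show ?case by auto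
  next
    case (8 z) then show ?case using w by (auto simp: \<theta>_def divide_simps)
  next
    case (9 z)
    have "\<not> (w * (1 + pad_width) \<le> w)" using w by (simp add: pad_width_def)
    with 9 show ?case using w by (auto simp: \<theta>_def pad_width_def)
  qed
  then show ?thesis by blast
qed

text \<open>Real power with the convention that the zeroth power is always 1 (\<open>0 powr 0 = 0\<close>).\<close>

definition rpow :: "real \<Rightarrow> real \<Rightarrow> real" where
  "rpow x a = (if a = 0 then 1 else x powr a)"

definition repaired_map :: "nat \<Rightarrow> (complex \<Rightarrow> real) \<Rightarrow> complex \<Rightarrow> complex" where
  "repaired_map N \<theta> z =
     (let R_raw = pade_exp 0 N z; R_fix = pade_exp 1 (N - 1) z; t = \<theta> z in
        of_real (rpow (cmod R_fix) t * rpow (cmod R_raw) (1 - t)) *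
        exp (\<i> * of_real ((1 - t) * Arg R_raw + t * Arg R_fix)))"


section \<open>The schemes and their dissipative parents\<close>

datatype scheme = MIISO2 | MIISO3 | MIISO4

fun is_dissipative_parent :: "scheme \<Rightarrow> (complex \<Rightarrow> complex) \<Rightarrow> bool" where
  "is_dissipative_parent MIISO2 R \<longleftrightarrow> R = pade_exp 0 2"
| "is_dissipative_parent MIISO3 R \<longleftrightarrow> (\<exists>\<theta>. is_wedge_weight 3 \<theta> \<and> R = repaired_map 3 \<theta>)"
| "is_dissipative_parent MIISO4 R \<longleftrightarrow> (\<exists>\<theta>. is_wedge_weight 4 \<theta> \<and> R = repaired_map 4 \<theta>)"


section \<open>The cutoff\<close>

text \<open>
  The modulus of the \<open>k\<close>-th largest-magnitude eigenvalue of \<open>h J\<close>, with \<open>k\<close> counted from 1 and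
  eigenvalues counted with algebraic multiplicity.
\<close>

definition cutoff :: "real mat \<Rightarrow> nat \<Rightarrow> real \<Rightarrow> real" where
  "cutoff J k h =
     rev (sorted_list_of_multiset
       (image_mset cmod (proots (char_poly (map_mat complex_of_real (h \<cdot>\<^sub>m J)))))) ! (k - 1)"

end

theory Submission
  imports
    Defs
    "HOL-Analysis.Complex_Transcendental"
    "HOL-Real_Asymp.Real_Asymp"
begin

text \<open>
  On the imaginary axis near 0 the repaired maps coincide with \<open>[1/(N-1)]\<close>, since
  \<open>|Q\<^sub>N(iy)| < 1\<close> there. In all three cases the Pade approximant satisfies
  \<open>|R\<^sub>D(iy)|\<^sup>2 = 1 / (1 + c y\<^sup>q / (1 + b y\<^sup>2))\<close> with \<open>b = 0, 1/9, 1/16\<close>, so that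
  \<open>ln |R\<^sub>D(iy)| / y\<^sup>q\<close> tends to \<open>- c/2\<close>; raising to the power \<open>T/h\<close> gives the claim.
\<close>

section \<open>Vanishing order at 0 of polynomials and of the exponential remainder\<close>

lemma tendsto_0_bigo:
  fixes f g :: "'a \<Rightarrow> complex"
  assumes "f \<in> O[F](g)" "(g \<longlongrightarrow> 0) F"
  shows "(f \<longlongrightarrow> 0) F"
proof -
  have "g \<in> o[F](\<lambda>_. 1)"
    using assms(2) by (intro smalloI_tendsto) auto
  with assms(1) have "f \<in> o[F](\<lambda>_. 1)"
    by (rule landau_o.big_small_trans)
  then show ?thesis
    using smalloD_tendsto by fastforce
qed

text \<open>A nonzero \<open>p\<close> factors as \<open>z ^ m * r\<close> with \<open>r\<close>
  nonzero at 0 and \<open>m\<close> at most the degree, hence below \<open>k\<close>. Cancelling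
  \<open>z ^ m\<close> leaves \<open>r\<close> of order \<open>z ^ (k - m)\<close>, which forces
  \<open>r\<close> to vanish at 0 after all.\<close>

lemma poly_eq_0_if_bigo:
  fixes p :: "complex poly"
  assumes "degree p < k" and O: "poly p \<in> O[at 0](\<lambda>z. z ^ k)"
  shows "p = 0"
proof (rule ccontr)
  assume "p \<noteq> 0"
  define m where "m = order 0 p"
  from order_decomp[OF \<open>p \<noteq> 0\<close>, of 0] obtain r where r: "p = [:0, 1:] ^ m * r" "\<not> [:0, 1:] dvd r"
    by (auto simp: m_def)
  have "m < k"
    using order_degree[OF \<open>p \<noteq> 0\<close>, of 0] assms(1) by (simp add: m_def)
  have "poly p = (\<lambda>z. z ^ m * poly r z)"
    by (simp add: fun_eq_iff r(1))
  with O have "(\<lambda>z. z ^ m * poly r z) \<in> O[at 0](\<lambda>z. z ^ m * z ^ (k - m))"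
    using \<open>m < k\<close> by (simp flip: power_add)
  moreover have ev: "\<forall>\<^sub>F z::complex in at 0. z ^ m \<noteq> 0"
    using eventually_neq_at_within[of 0] by eventually_elim simp
  ultimately have "poly r \<in> O[at 0](\<lambda>z. z ^ (k - m))"
    by (simp only: landau_o.big.mult_cancel_left[OF bigtheta_refl ev])
  moreover have "((\<lambda>z::complex. z ^ (k - m)) \<longlongrightarrow> 0) (at 0)"
    using \<open>m < k\<close> by (auto intro!: tendsto_eq_intros)
  ultimately have "(poly r \<longlongrightarrow> 0) (at 0)"
    by (rule tendsto_0_bigo)
  moreover have "(poly r \<longlongrightarrow> poly r 0) (at 0)"
    by (intro tendsto_poly tendsto_ident_at)
  ultimately have "poly r 0 = 0"
    using tendsto_unique[OF at_neq_bot] by blast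
  then show False
    using r(2) by (simp add: poly_eq_0_iff_dvd)
qed

lemma exp_taylor_bigo:
  "(\<lambda>z::complex. exp z - (\<Sum>k\<le>n. z ^ k / fact k)) \<in> O[at 0](\<lambda>z. z ^ Suc n)"
proof (rule bigoI)
  have "((\<lambda>z::complex. exp (norm z)) \<longlongrightarrow> exp (norm (0::complex))) (at 0)"
    by (intro tendsto_intros)
  \<comment> \<open>The limit is 1, so 2 can serve as the big-O constant below.\<close>
  then have "\<forall>\<^sub>F z::complex in at 0. exp (norm z) < 2"
    by (rule order_tendstoD) simp
  then show "\<forall>\<^sub>F z::complex in at 0.
      norm (exp z - (\<Sum>k\<le>n. z ^ k / fact k)) \<le> 2 * norm (z ^ Suc n)"
  proof eventually_elim
    case (elim z)
    have "norm (exp z - (\<Sum>k\<le>n. z ^ k / fact k)) \<le> exp (norm z) * norm z ^ Suc n / fact n"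
      by (rule Taylor_exp_field)
    also have "\<dots> \<le> exp (norm z) * norm z ^ Suc n / 1"
      by (intro divide_left_mono) (auto simp: fact_ge_1)
    also have "\<dots> \<le> 2 * norm z ^ Suc n"
      using elim by (simp only: div_by_1, intro mult_right_mono) auto
    finally show ?case
      by (simp add: norm_power norm_mult)
  qed
qed

section \<open>Existence criterion and uniqueness of Pade approximants\<close>

lemma poly_tendsto_1:
  fixes Q :: "complex poly"
  assumes "poly Q 0 = 1"
  shows "(poly Q \<longlongrightarrow> 1) (at 0)"
  using tendsto_poly[OF tendsto_ident_at, of Q 0 UNIV] assms by simp

lemma eventually_poly_nonzero:
  fixes Q :: "complex poly"
  assumes "poly Q 0 = 1"
  shows "\<forall>\<^sub>F z in at 0. poly Q z \<noteq> 0"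
  using tendsto_imp_eventually_ne[OF poly_tendsto_1[OF assms]] by simp

text \<open>Trades the analytic error condition for a polynomial identity: \<open>exp\<close> agrees
  with its Taylor polynomial of degree \<open>m + n\<close> to the required order, and
  \<open>Q\<close> tends to 1, so dividing by it keeps that order. The cofactor \<open>r\<close>
  certifies the vanishing order.\<close>

lemma is_pade_expI:
  assumes "degree P = m" "degree Q = n" and Q: "poly Q 0 = 1"
    and r: "\<And>z. poly Q z * (\<Sum>k\<le>m + n. z ^ k / fact k) - poly P z = z ^ (m + n + 1) * poly r z"
  shows "is_pade_exp m n P Q"
  unfolding is_pade_exp_def
proof (intro conjI assms(1-3))
  let ?S = "\<lambda>z::complex. \<Sum>k\<le>m + n. z ^ k / fact k"
  have "((\<lambda>z. poly r z / poly Q z) \<longlongrightarrow> poly r 0 / 1) (at 0)"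
    by (intro tendsto_intros poly_tendsto_1 Q) auto
  then have "(\<lambda>z. poly r z / poly Q z) \<in> O[at 0](\<lambda>_. 1)"
    by (intro bigoI_tendsto) auto
  then have "(\<lambda>z. z ^ (m + n + 1) * (poly r z / poly Q z)) \<in> O[at 0](\<lambda>z. z ^ (m + n + 1) * 1)"
    by (intro landau_o.big.mult) auto
  \<comment> \<open>The error of \<open>P / Q\<close> splits into the Taylor remainder and
    \<open>z ^ (m + n + 1) * r / Q\<close>.\<close>
  then have "(\<lambda>z. (exp z - ?S z) + z ^ (m + n + 1) * (poly r z / poly Q z))
      \<in> O[at 0](\<lambda>z. z ^ (m + n + 1))"
    using exp_taylor_bigo[of "m + n"] by (intro sum_in_bigo(1)) simp_all
  moreover have "\<forall>\<^sub>F z in at 0. (exp z - ?S z) + z ^ (m + n + 1) * (poly r z / poly Q z)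
      = exp z - poly P z / poly Q z"
    using eventually_poly_nonzero[OF Q]
  proof eventually_elim
    case (elim z)
    have "z ^ (m + n + 1) * (poly r z / poly Q z) = (poly Q z * ?S z - poly P z) / poly Q z"
      by (simp only: r times_divide_eq_right)
    also have "\<dots> = ?S z - poly P z / poly Q z"
      using elim by (simp add: diff_divide_distrib)
    finally show ?case by simp
  qed
  ultimately show "(\<lambda>z. exp z - poly P z / poly Q z) \<in> O[at 0](\<lambda>z. z ^ (m + n + 1))"
    by (simp only: landau_o.big.in_cong)
qed

text \<open>The error tends to 0 at 0 and \<open>Q\<close> is normalised there, so \<open>P\<close>
  inherits the value of \<open>exp\<close> at 0. This later rules out \<open>P = 0\<close> and fixes
  a free scalar.\<close>

lemma is_pade_exp_poly_0:
  assumes "is_pade_exp m n P Q"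
  shows "poly P 0 = 1"
proof -
  have Q: "poly Q 0 = 1"
    and O: "(\<lambda>z. exp z - poly P z / poly Q z) \<in> O[at 0](\<lambda>z. z ^ (m + n + 1))"
    using assms by (auto simp: is_pade_exp_def)
  have "((\<lambda>z::complex. z ^ (m + n + 1)) \<longlongrightarrow> 0) (at 0)"
    by (auto intro!: tendsto_eq_intros)
  with O have "((\<lambda>z. exp z - poly P z / poly Q z) \<longlongrightarrow> 0) (at 0)"
    by (rule tendsto_0_bigo)
  moreover have "((\<lambda>z. exp z - poly P z / poly Q z) \<longlongrightarrow> exp 0 - poly P 0 / 1) (at 0)"
    by (intro tendsto_intros poly_tendsto_1 Q) auto
  ultimately have "exp 0 - poly P 0 / 1 = 0"
    using tendsto_unique[OF at_neq_bot] by blast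
  then show ?thesis by simp
qed

text \<open>The classical uniqueness argument: the difference of the two errors, multiplied by
  \<open>Q * Q'\<close>, is a polynomial that vanishes to an order above its degree.\<close>

lemma is_pade_exp_cross:
  assumes PQ: "is_pade_exp m n P Q" and PQ': "is_pade_exp m n P' Q'"
  shows "P * Q' = P' * Q"
proof -
  have Q: "poly Q 0 = 1" "poly Q' 0 = 1"
    and deg: "degree P = m" "degree Q = n" "degree P' = m" "degree Q' = n"
    using assms by (auto simp: is_pade_exp_def)
  have "(\<lambda>z. (exp z - poly P' z / poly Q' z) - (exp z - poly P z / poly Q z))
      \<in> O[at 0](\<lambda>z. z ^ (m + n + 1))"
    using assms
    by (intro sum_in_bigo(2)[of "\<lambda>z. exp z - poly P' z / poly Q' z"]) (simp_all add: is_pade_exp_def)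
  moreover have "((\<lambda>z. poly Q z * poly Q' z) \<longlongrightarrow> 1 * 1) (at 0)"
    by (intro tendsto_intros poly_tendsto_1 Q)
  then have "(\<lambda>z. poly Q z * poly Q' z) \<in> O[at 0](\<lambda>_. 1)"
    by (intro bigoI_tendsto) auto
  ultimately have "(\<lambda>z. ((exp z - poly P' z / poly Q' z) - (exp z - poly P z / poly Q z))
      * (poly Q z * poly Q' z)) \<in> O[at 0](\<lambda>z. z ^ (m + n + 1) * 1)"
    by (rule landau_o.big.mult)
  moreover have ev: "\<forall>\<^sub>F z in at 0. ((exp z - poly P' z / poly Q' z) - (exp z - poly P z / poly Q z))
      * (poly Q z * poly Q' z) = poly (P * Q' - P' * Q) z"
    using eventually_poly_nonzero[OF Q(1)] eventually_poly_nonzero[OF Q(2)]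
    by eventually_elim (simp add: field_simps)
  ultimately have "poly (P * Q' - P' * Q) \<in> O[at 0](\<lambda>z. z ^ (m + n + 1))"
    by (simp only: landau_o.big.in_cong[OF ev] mult_1_right)
  \<comment> \<open>Degree at most \<open>m + n\<close> against order \<open>m + n + 1\<close>:
    exactly one to spare.\<close>
  moreover have "degree (P * Q' - P' * Q) < m + n + 1"
    using degree_diff_le[of "P * Q'" "m + n" "P' * Q"]
      degree_mult_le[of P Q'] degree_mult_le[of P' Q] deg by simp
  ultimately show ?thesis
    using poly_eq_0_if_bigo by fastforce
qed

text \<open>The Bezout identity makes \<open>P\<close> and \<open>Q\<close> coprime, so the cross
  identity yields that \<open>P\<close> divides \<open>P'\<close>. Equal degrees make the quotient a
  constant, and the common value 1 at 0 makes it 1.\<close>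

lemma is_pade_exp_unique:
  assumes PQ: "is_pade_exp m n P Q" and bezout: "P * A + Q * B = 1" and PQ': "is_pade_exp m n P' Q'"
  shows "P' = P" "Q' = Q"
proof -
  note cross = is_pade_exp_cross[OF PQ PQ']
  note P_0 = is_pade_exp_poly_0[OF PQ] and P'_0 = is_pade_exp_poly_0[OF PQ']
  have "P' = P' * (P * A + Q * B)"
    by (simp add: bezout)
  also have "\<dots> = P * (P' * A) + (P' * Q) * B"
    by (simp only: algebra_simps)
  also have "\<dots> = P * (P' * A + Q' * B)"
    unfolding cross[symmetric] by (simp only: algebra_simps)
  finally have "P dvd P'" ..
  then obtain C where C: "P' = P * C" ..
  have "P \<noteq> 0" "C \<noteq> 0"
    using P_0 P'_0 C by auto
  moreover have "degree P = degree P'"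
    using PQ PQ' by (simp add: is_pade_exp_def)
  ultimately have "degree C = 0"
    by (simp add: C degree_mult_eq)
  then obtain c where "C = [:c:]"
    by (rule degree_eq_zeroE)
  moreover have "poly C 0 = 1"
    using P_0 P'_0 by (simp add: C)
  ultimately have "C = 1"
    by simp
  then show "P' = P"
    by (simp add: C)
  with cross \<open>P \<noteq> 0\<close> show "Q' = Q"
    by simp
qed

text \<open>The definite description in \<open>pade_exp\<close> can be evaluated only once
  uniqueness is known; the Bezout certificate supplies it.\<close>

lemma pade_exp_eq:
  assumes "is_pade_exp m n P Q" "P * A + Q * B = 1"
  shows "pade_exp m n z = poly P z / poly Q z"
proof -
  have "(THE (P, Q). is_pade_exp m n P Q) = (P, Q)"
  proof (rule the_equality)
    show "case (P, Q) of (P, Q) \<Rightarrow> is_pade_exp m n P Q"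
      using assms(1) by simp
    fix X assume "case X of (P, Q) \<Rightarrow> is_pade_exp m n P Q"
    then have "is_pade_exp m n (fst X) (snd X)"
      by (simp add: case_prod_beta)
    from is_pade_exp_unique[OF assms this] show "X = (P, Q)"
      by (simp add: prod_eq_iff)
  qed
  then show ?thesis
    by (simp add: pade_exp_def)
qed

section \<open>Closed forms of the approximants [0/2], [1/2] and [1/3]\<close>

lemma pade_exp_0_2: "pade_exp 0 2 z = 1 / (1 - z + z\<^sup>2 / 2)"
proof -
  have "is_pade_exp 0 2 1 [:1, -1, 1/2:]"
    by (rule is_pade_expI[where r = "[:0, 1/4:]"]) (simp_all add: eval_nat_numeral field_simps)
  then have "pade_exp 0 2 z = poly 1 z / poly [:1, -1, 1/2:] z"
    by (rule pade_exp_eq[where A = 1 and B = 0]) simp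
  then show ?thesis
    by (simp add: field_simps power2_eq_square)
qed

lemma pade_exp_1_2: "pade_exp 1 2 z = (1 + z / 3) / (1 - 2 * z / 3 + z\<^sup>2 / 6)"
proof -
  \<comment> \<open>The witness \<open>r\<close> lists the coefficients from degree 4 on of
    \<open>Q\<close> times the cubic Taylor polynomial.\<close>
  have "is_pade_exp 1 2 [:1, 1/3:] [:1, -2/3, 1/6:]"
    by (rule is_pade_expI[where r = "[:-1/36, 1/36:]"]) (simp_all add: eval_nat_numeral field_simps)
  \<comment> \<open>The root of \<open>P\<close> is -3, so \<open>B\<close> is the constant 1/Q(-3)
    = 2/9, and \<open>A\<close> is the quotient of \<open>1 - Q * B\<close> by
    \<open>P\<close>.\<close>
  then have "pade_exp 1 2 z = poly [:1, 1/3:] z / poly [:1, -2/3, 1/6:] z"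
    by (rule pade_exp_eq[where A = "[:7/9, -1/9:]" and B = "[:2/9:]"]) simp
  then show ?thesis
    by (simp add: algebra_simps power2_eq_square)
qed

lemma pade_exp_1_3:
  "pade_exp 1 3 z = (1 + z / 4) / (1 - 3 * z / 4 + z\<^sup>2 / 4 - z ^ 3 / 24)"
proof -
  have "is_pade_exp 1 3 [:1, 1/4:] [:1, -3/4, 1/4, -1/24:]"
    by (rule is_pade_expI[where r = "[:-1/96, 1/288, -1/576:]"])
      (simp_all add: eval_nat_numeral field_simps)
  \<comment> \<open>Same recipe with the root -4 and Q(-4) = 32/3.\<close>
  then have "pade_exp 1 3 z = poly [:1, 1/4:] z / poly [:1, -3/4, 1/4, -1/24:] z"
    by (rule pade_exp_eq[where A = "[:29/32, -5/32, 1/64:]" and B = "[:3/32:]"]) simp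
  then show ?thesis
    by (simp add: algebra_simps eval_nat_numeral)
qed

section \<open>The repaired map on the wedge and near 0 on the imaginary axis\<close>

text \<open>At weight 1 the raw factor has exponent 0 and equals 1 by the convention in
  \<open>rpow\<close>; the phase factor has modulus 1.\<close>

lemma cmod_repaired_map_wedge:
  assumes "is_wedge_weight N \<theta>" "z \<in> wedge N"
  shows "cmod (repaired_map N \<theta> z) = cmod (pade_exp 1 (N - 1) z)"
proof -
  have "\<theta> z = 1"
    using assms by (simp add: is_wedge_weight_def)
  then show ?thesis
    by (simp add: repaired_map_def rpow_def Let_def norm_mult)
qed

lemma cmod_less_1_iff: "cmod z < 1 \<longleftrightarrow> (Re z)\<^sup>2 + (Im z)\<^sup>2 < 1"
  by (simp add: cmod_def)

text \<open>The squared modulus falls short of 1 by \<open>y ^ 4 / 12 * (1 - y\<^sup>2 / 3)\<close>,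
  which changes sign at sqrt 3, the value of \<open>omega_star 3\<close>. The bound 1 is a
  convenient smaller one.\<close>

lemma imaginary_in_wedge_3:
  assumes "0 < y" "y < 1"
  shows "\<i> * of_real y \<in> wedge 3"
proof -
  have Q: "Q_poly 3 (\<i> * of_real y) = Complex (1 - y\<^sup>2 / 2) (y ^ 3 / 6 - y)"
    by (simp add: Q_poly_def eval_nat_numeral complex_eq_iff field_simps)
  have "(1 - y\<^sup>2 / 2)\<^sup>2 + (y ^ 3 / 6 - y)\<^sup>2 = 1 - y ^ 4 / 12 * (1 - y\<^sup>2 / 3)"
    by (simp add: eval_nat_numeral field_simps)
  also have "\<dots> < 1"
    using assms power_strict_mono[of y 1 2] by simp
  finally show ?thesis
    by (simp add: wedge_def Q cmod_less_1_iff)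
qed

text \<open>As for degree 3, with the sign change now at sqrt 8, the value of
  \<open>omega_star 4\<close>.\<close>

lemma imaginary_in_wedge_4:
  assumes "0 < y" "y < 1"
  shows "\<i> * of_real y \<in> wedge 4"
proof -
  have Q: "Q_poly 4 (\<i> * of_real y) = Complex (1 - y\<^sup>2 / 2 + y ^ 4 / 24) (y ^ 3 / 6 - y)"
    by (simp add: Q_poly_def eval_nat_numeral complex_eq_iff field_simps)
  have "(1 - y\<^sup>2 / 2 + y ^ 4 / 24)\<^sup>2 + (y ^ 3 / 6 - y)\<^sup>2 = 1 - y ^ 6 / 72 * (1 - y\<^sup>2 / 8)"
    by (simp add: eval_nat_numeral field_simps)
  also have "\<dots> < 1"
    using assms power_strict_mono[of y 1 2] by simp
  finally show ?thesis
    by (simp add: wedge_def Q cmod_less_1_iff)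
qed

section \<open>Moduli of the approximants on the imaginary axis\<close>

lemma cmod_pade_exp_0_2:
  "cmod (pade_exp 0 2 (\<i> * of_real y)) = 1 / sqrt (1 + y ^ 4 / 4)"
proof -
  have "1 - \<i> * of_real y + (\<i> * of_real y)\<^sup>2 / 2 = Complex (1 - y\<^sup>2 / 2) (- y)"
    by (simp add: complex_eq_iff power2_eq_square)
  moreover have "(1 - y\<^sup>2 / 2)\<^sup>2 + (- y)\<^sup>2 = 1 + y ^ 4 / 4"
    by (simp add: eval_nat_numeral field_simps)
  ultimately show ?thesis
    by (simp only: pade_exp_0_2 norm_divide norm_one complex_norm)
qed

text \<open>The squared moduli of numerator and denominator agree up to degree 2; the excess
  \<open>y ^ 4 / 36\<close> is the source of \<open>c\<close> and \<open>q\<close>.\<close>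

lemma cmod_pade_exp_1_2:
  "cmod (pade_exp 1 2 (\<i> * of_real y)) = sqrt (1 + y\<^sup>2 / 9) / sqrt (1 + y\<^sup>2 / 9 + y ^ 4 / 36)"
proof -
  have "1 + \<i> * of_real y / 3 = Complex 1 (y / 3)"
    by (simp add: complex_eq_iff)
  moreover have "1 - 2 * (\<i> * of_real y) / 3 + (\<i> * of_real y)\<^sup>2 / 6
      = Complex (1 - y\<^sup>2 / 6) (- 2 * y / 3)"
    by (simp add: complex_eq_iff power2_eq_square)
  moreover have "(1 - y\<^sup>2 / 6)\<^sup>2 + (- 2 * y / 3)\<^sup>2 = 1 + y\<^sup>2 / 9 + y ^ 4 / 36"
    by (simp add: eval_nat_numeral field_simps)
  ultimately show ?thesis
    by (simp only: pade_exp_1_2 norm_divide complex_norm) (simp add: power_divide)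
qed

text \<open>In the denominator the terms of degree 4, namely 1/16 and -1/16, cancel. The excess over
  the numerator therefore starts at degree 6.\<close>

lemma cmod_pade_exp_1_3:
  "cmod (pade_exp 1 3 (\<i> * of_real y)) = sqrt (1 + y\<^sup>2 / 16) / sqrt (1 + y\<^sup>2 / 16 + y ^ 6 / 576)"
proof -
  have "1 + \<i> * of_real y / 4 = Complex 1 (y / 4)"
    by (simp add: complex_eq_iff)
  moreover have "1 - 3 * (\<i> * of_real y) / 4 + (\<i> * of_real y)\<^sup>2 / 4 - (\<i> * of_real y) ^ 3 / 24
      = Complex (1 - y\<^sup>2 / 4) (y ^ 3 / 24 - 3 * y / 4)"
    by (simp add: complex_eq_iff eval_nat_numeral)
  moreover have "(1 - y\<^sup>2 / 4)\<^sup>2 + (y ^ 3 / 24 - 3 * y / 4)\<^sup>2 = 1 + y\<^sup>2 / 16 + y ^ 6 / 576"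
    by (simp add: eval_nat_numeral field_simps)
  ultimately show ?thesis
    by (simp only: pade_exp_1_3 norm_divide complex_norm) (simp add: power_divide)
qed

section \<open>Leading order of the logarithmic damping per step\<close>

lemma eventually_at_right_0_less_1: "\<forall>\<^sub>F y::real in at_right 0. 0 < y \<and> y < 1"
  by (auto simp: eventually_at_right_field intro: exI[of _ 1])

lemma ln_parent_asymp:
  assumes parent: "is_dissipative_parent M R"
    and params: "(M, c, q, p) \<in>
      {(MIISO2, 1 / 4, 4, 3), (MIISO3, 1 / 36, 4, 3), (MIISO4, 1 / 576, 6, 5)}"
  shows "\<forall>\<^sub>F y in at_right 0. cmod (R (\<i> * of_real y)) > 0"
    and "((\<lambda>y. ln (cmod (R (\<i> * of_real y))) / y ^ q) \<longlongrightarrow> - (c / 2)) (at_right 0)"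
proof -
  \<comment> \<open>An explicit real function \<open>f\<close> replaces the complex modulus, so that
    the limits become real asymptotics of elementary functions.\<close>
  obtain f where "\<forall>\<^sub>F y in at_right 0. cmod (R (\<i> * of_real y)) = f y"
    and "\<forall>\<^sub>F y in at_right 0. f y > 0"
    and "((\<lambda>y. ln (f y) / y ^ q) \<longlongrightarrow> - (c / 2)) (at_right 0)"
  proof (cases M)
    case MIISO2
    then have "R = pade_exp 0 2"
      using parent by simp
    show ?thesis
    proof (rule that[of "\<lambda>y. 1 / sqrt (1 + y ^ 4 / 4)"])
      show "\<forall>\<^sub>F y in at_right 0. cmod (R (\<i> * of_real y)) = 1 / sqrt (1 + y ^ 4 / 4)"
        by (simp only: \<open>R = _\<close> cmod_pade_exp_0_2 eventually_True simp_thms)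
      show "\<forall>\<^sub>F y::real in at_right 0. 1 / sqrt (1 + y ^ 4 / 4) > 0"
        by real_asymp
      \<comment> \<open>The limit is computed with literal numbers and matched with \<open>c\<close>
        and \<open>q\<close> afterwards.\<close>
      have "((\<lambda>y::real. ln (1 / sqrt (1 + y ^ 4 / 4)) / y ^ 4) \<longlongrightarrow> - (1 / 8)) (at_right 0)"
        by real_asymp
      moreover have "c / 2 = 1 / 8" "q = 4"
        using params MIISO2 by auto
      ultimately show "((\<lambda>y. ln (1 / sqrt (1 + y ^ 4 / 4)) / y ^ q) \<longlongrightarrow> - (c / 2)) (at_right 0)"
        by (simp only:)
    qed
  next
    case MIISO3
    then obtain \<theta> where \<theta>: "is_wedge_weight 3 \<theta>" "R = repaired_map 3 \<theta>"
      using parent by auto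
    let ?f = "\<lambda>y::real. sqrt (1 + y\<^sup>2 / 9) / sqrt (1 + y\<^sup>2 / 9 + y ^ 4 / 36)"
    show ?thesis
    proof (rule that[of ?f])
      show "\<forall>\<^sub>F y in at_right 0. cmod (R (\<i> * of_real y)) = ?f y"
        using eventually_at_right_0_less_1
      proof eventually_elim
        case (elim y)
        have "cmod (R (\<i> * of_real y)) = cmod (pade_exp 1 (3 - 1) (\<i> * of_real y))"
          unfolding \<theta>(2) using elim by (intro cmod_repaired_map_wedge \<theta>(1) imaginary_in_wedge_3) auto
        then show ?case
          using cmod_pade_exp_1_2[of y] by simp
      qed
      show "\<forall>\<^sub>F y in at_right 0. ?f y > 0"
        by real_asymp
      have "((\<lambda>y. ln (?f y) / y ^ 4) \<longlongrightarrow> - (1 / 72)) (at_right 0)"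
        by real_asymp
      moreover have "c / 2 = 1 / 72" "q = 4"
        using params MIISO3 by auto
      ultimately show "((\<lambda>y. ln (?f y) / y ^ q) \<longlongrightarrow> - (c / 2)) (at_right 0)"
        by (simp only:)
    qed
  next
    case MIISO4
    then obtain \<theta> where \<theta>: "is_wedge_weight 4 \<theta>" "R = repaired_map 4 \<theta>"
      using parent by auto
    let ?f = "\<lambda>y::real. sqrt (1 + y\<^sup>2 / 16) / sqrt (1 + y\<^sup>2 / 16 + y ^ 6 / 576)"
    show ?thesis
    proof (rule that[of ?f])
      show "\<forall>\<^sub>F y in at_right 0. cmod (R (\<i> * of_real y)) = ?f y"
        using eventually_at_right_0_less_1
      proof eventually_elim
        case (elim y)
        have "cmod (R (\<i> * of_real y)) = cmod (pade_exp 1 (4 - 1) (\<i> * of_real y))"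
          unfolding \<theta>(2) using elim by (intro cmod_repaired_map_wedge \<theta>(1) imaginary_in_wedge_4) auto
        then show ?case
          using cmod_pade_exp_1_3[of y] by simp
      qed
      show "\<forall>\<^sub>F y in at_right 0. ?f y > 0"
        by real_asymp
      have "((\<lambda>y. ln (?f y) / y ^ 6) \<longlongrightarrow> - (1 / 1152)) (at_right 0)"
        by real_asymp
      moreover have "c / 2 = 1 / 1152" "q = 6"
        using params MIISO4 by auto
      ultimately show "((\<lambda>y. ln (?f y) / y ^ q) \<longlongrightarrow> - (c / 2)) (at_right 0)"
        by (simp only:)
    qed
  qed
  note f = this
  show "\<forall>\<^sub>F y in at_right 0. cmod (R (\<i> * of_real y)) > 0"
    using f(1,2) by eventually_elim simp
  have "\<forall>\<^sub>F y in at_right 0. ln (cmod (R (\<i> * of_real y))) / y ^ q = ln (f y) / y ^ q"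
    using f(1) by eventually_elim simp
  with f(3) show "((\<lambda>y. ln (cmod (R (\<i> * of_real y))) / y ^ q) \<longlongrightarrow> - (c / 2)) (at_right 0)"
    by (simp only: tendsto_cong)
qed

section \<open>From one step to the whole window\<close>

text \<open>The logarithm of the power is \<open>T / h\<close> times a quantity of order
  \<open>h ^ q\<close>; the division by \<open>h\<close> costs one power, hence \<open>p\<close>.
  The rate is stated for the logarithm because the power itself tends to 1.\<close>

lemma powr_step_asymp:
  fixes f :: "real \<Rightarrow> real"
  assumes pos: "\<forall>\<^sub>F y in at_right 0. f y > 0"
    and lim: "((\<lambda>y. ln (f y) / y ^ q) \<longlongrightarrow> - (c / 2)) (at_right 0)"
    and "c > 0" "\<omega> > 0" "T > 0" "q = Suc p" "p > 0"
  shows "((\<lambda>h. exp (- (c / 2) * T * h ^ p * \<omega> ^ q)) \<longlongrightarrow> 1) (at_right 0)"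
    and "\<exists>\<epsilon> :: real \<Rightarrow> real. \<epsilon> \<in> o[at_right 0](\<lambda>_. 1) \<and>
      (\<forall>\<^sub>F h in at_right 0. f (h * \<omega>) powr (T / h) =
        exp (- (c / 2) * T * h ^ p * \<omega> ^ q) * (1 + \<epsilon> h))"
    and "(\<lambda>h. ln (f (h * \<omega>) powr (T / h))) \<in> \<Theta>[at_right 0](\<lambda>h. h ^ p)"
proof -
  define L where "L h = ln (f (h * \<omega>)) / (h * \<omega>) ^ q" for h
  have scale: "filterlim (\<lambda>h. h * \<omega>) (at_right 0) (at_right 0)"
    using \<open>\<omega> > 0\<close> by real_asymp
  have L: "(L \<longlongrightarrow> - (c / 2)) (at_right 0)"
    unfolding L_def by (rule filterlim_compose[OF lim scale])
  have pos': "\<forall>\<^sub>F h in at_right 0. f (h * \<omega>) > 0"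
    using pos scale by (rule eventually_compose_filterlim)
  have h_pow: "((\<lambda>h::real. h ^ p) \<longlongrightarrow> 0) (at_right 0)"
    using \<open>p > 0\<close> by (auto intro!: tendsto_eq_intros)
  have h_pos: "\<forall>\<^sub>F h::real in at_right 0. h > 0"
    by (rule eventually_at_right_less)
  have ln_eq: "\<forall>\<^sub>F h in at_right 0. ln (f (h * \<omega>) powr (T / h)) = T * h ^ p * \<omega> ^ q * L h"
    using pos' h_pos
    by eventually_elim (use \<open>\<omega> > 0\<close> in \<open>simp add: L_def ln_powr \<open>q = Suc p\<close> field_simps\<close>)

  have "((\<lambda>h. exp (- (c / 2) * T * h ^ p * \<omega> ^ q)) \<longlongrightarrow> exp (- (c / 2) * T * 0 * \<omega> ^ q)) (at_right 0)"
    by (intro tendsto_intros h_pow)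
  then show "((\<lambda>h. exp (- (c / 2) * T * h ^ p * \<omega> ^ q)) \<longlongrightarrow> 1) (at_right 0)"
    by simp

  \<comment> \<open>Chosen so that \<open>1 + \<epsilon> h\<close> is exactly the retained amplitude
    divided by the predicted exponential, wherever the logarithm formula holds.\<close>
  define \<epsilon> where "\<epsilon> h = exp (T * h ^ p * \<omega> ^ q * (L h + c / 2)) - 1" for h
  have "(\<epsilon> \<longlongrightarrow> exp (T * 0 * \<omega> ^ q * (- (c / 2) + c / 2)) - 1) (at_right 0)"
    unfolding \<epsilon>_def by (intro tendsto_intros h_pow L)
  then have "\<epsilon> \<in> o[at_right 0](\<lambda>_. 1)"
    by (intro smalloI_tendsto) auto
  moreover have "\<forall>\<^sub>F h in at_right 0. f (h * \<omega>) powr (T / h) =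
      exp (- (c / 2) * T * h ^ p * \<omega> ^ q) * (1 + \<epsilon> h)"
    using ln_eq pos'
  proof eventually_elim
    case (elim h)
    have "f (h * \<omega>) powr (T / h) = exp (ln (f (h * \<omega>) powr (T / h)))"
      using elim(2) by (intro exp_ln[symmetric]) simp
    also have "\<dots> = exp (- (c / 2) * T * h ^ p * \<omega> ^ q + T * h ^ p * \<omega> ^ q * (L h + c / 2))"
      unfolding elim(1) by (simp add: algebra_simps)
    finally show ?case
      unfolding exp_add by (simp add: \<epsilon>_def)
  qed
  ultimately show "\<exists>\<epsilon> :: real \<Rightarrow> real. \<epsilon> \<in> o[at_right 0](\<lambda>_. 1) \<and>
      (\<forall>\<^sub>F h in at_right 0. f (h * \<omega>) powr (T / h) =
        exp (- (c / 2) * T * h ^ p * \<omega> ^ q) * (1 + \<epsilon> h))"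
    by blast

  \<comment> \<open>The limit of the quotient by \<open>h ^ p\<close> is nonzero, which gives both
    directions of the Theta bound.\<close>
  have "((\<lambda>h. T * \<omega> ^ q * L h) \<longlongrightarrow> T * \<omega> ^ q * - (c / 2)) (at_right 0)"
    by (intro tendsto_intros L)
  moreover have "\<forall>\<^sub>F h in at_right 0. ln (f (h * \<omega>) powr (T / h)) / h ^ p = T * \<omega> ^ q * L h"
    using ln_eq h_pos by eventually_elim simp
  ultimately have "((\<lambda>h. ln (f (h * \<omega>) powr (T / h)) / h ^ p) \<longlongrightarrow> T * \<omega> ^ q * - (c / 2)) (at_right 0)"
    by (simp only: tendsto_cong)
  then show "(\<lambda>h. ln (f (h * \<omega>) powr (T / h))) \<in> \<Theta>[at_right 0](\<lambda>h. h ^ p)"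
    using \<open>T > 0\<close> \<open>\<omega> > 0\<close> \<open>c > 0\<close> h_pos
    by (intro bigthetaI_tendsto) (auto elim: eventually_mono)
qed

lemma cmod_amplitude:
  fixes a :: "nat \<Rightarrow> complex"
  assumes "\<And>n. a (Suc n) = r * a n"
  shows "cmod (a n) = cmod r ^ n * cmod (a 0)"
  by (induction n) (simp_all add: assms norm_mult)

text \<open>Both \<open>h * \<omega>\<close> and the cutoff are proportional to \<open>h\<close>, so
  being an outlier is independent of the step size. The recursion has whole steps only, so it is
  tied to the real power at those \<open>h\<close> where \<open>T / h\<close> is a natural
  number.\<close>

theorem corollary5p7:
  fixes M :: scheme
    and R_D :: "complex \<Rightarrow> complex"
    and J :: "real mat" and d k :: nat
    and \<omega> T c :: real and q p :: nat
    and a :: "real \<Rightarrow> nat \<Rightarrow> complex"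
  assumes parent: "is_dissipative_parent M R_D"
    and params: "(M, c, q, p) \<in>
      {(MIISO2, 1 / 4, 4, 3), (MIISO3, 1 / 36, 4, 3), (MIISO4, 1 / 576, 6, 5)}"
    and J: "J \<in> carrier_mat d d" and k: "1 \<le> k" "k \<le> d"
    and freq: "\<omega> > 0" and mode: "eigenvalue (map_mat complex_of_real J) (\<i> * of_real \<omega>)"
    and outlier: "\<And>h. h > 0 \<Longrightarrow> h * \<omega> \<ge> cutoff J k h"
    \<comment> \<open>\<open>a h n\<close> is the amplitude of the mode after \<open>n\<close> steps of size \<open>h\<close>\<close>
    and advance: "\<And>h n. h > 0 \<Longrightarrow> h * \<omega> \<ge> cutoff J k h \<Longrightarrow>
      a h (Suc n) = R_D (\<i> * of_real (h * \<omega>)) * a h n"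
    and T: "T > 0"
  shows "(\<forall>h n. h > 0 \<and> real n = T / h \<longrightarrow>
            cmod (a h n) = cmod (R_D (\<i> * of_real (h * \<omega>))) powr (T / h) * cmod (a h 0)) \<and>
         (\<exists>\<epsilon> :: real \<Rightarrow> real. \<epsilon> \<in> o[at_right 0](\<lambda>_. 1) \<and>
            (\<forall>\<^sub>F h in at_right 0.
               cmod (R_D (\<i> * of_real (h * \<omega>))) powr (T / h) =
               exp (- (c / 2) * T * h ^ (q - 1) * \<omega> ^ q) * (1 + \<epsilon> h))) \<and>
         ((\<lambda>h. exp (- (c / 2) * T * h ^ (q - 1) * \<omega> ^ q)) \<longlongrightarrow> 1) (at_right 0) \<and>
         q - 1 = p \<and>
         (\<lambda>h. ln (cmod (R_D (\<i> * of_real (h * \<omega>))) powr (T / h))) \<in> \<Theta>[at_right 0](\<lambda>h. h ^ p)"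
proof -
  have pq: "q - 1 = p" "q = Suc p" "p > 0" "c > 0"
    using params by auto
  have amplitude: "cmod (a h n) = cmod (R_D (\<i> * of_real (h * \<omega>))) powr (T / h) * cmod (a h 0)"
    if "h > 0" "real n = T / h" for h n
  proof -
    \<comment> \<open>A nonzero step count is what lets \<open>powr\<close> match the natural power:
      for base 0 they differ at exponent 0.\<close>
    have "T / h > 0"
      using \<open>h > 0\<close> T by simp
    then have "n \<noteq> 0"
      by (auto simp flip: that(2))
    moreover have "cmod (a h n) = cmod (R_D (\<i> * of_real (h * \<omega>))) ^ n * cmod (a h 0)"
      using advance[OF \<open>h > 0\<close> outlier[OF \<open>h > 0\<close>]] by (rule cmod_amplitude)
    ultimately show ?thesis
      by (simp add: powr_realpow' flip: that(2))
  qed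
  show ?thesis
    using amplitude powr_step_asymp[OF ln_parent_asymp[OF parent params] \<open>c > 0\<close> freq T pq(2,3)]
    unfolding pq(1) by blast
qed

end
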